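(* Let $n\ge 1$ be an integer. Among all finite groups of order $n$, the cyclic group $\mathbb{Z}_n$ has the maximum number of edges in its (undirected) power graph; that is, for every finite group $G$ of order $n$, $|E(G)|\le |E(\mathbb{Z}_n)|$.
   Context: For a finite group $G$, the (undirected) power graph $\mathcal{P}(G)$ is the simple undirected graph with vertex set $G$ in which two distinct elements $g,h$ are adjacent if and only if one of them is a positive power of the other (i.e. $h\in\langle g\rangle$ or $g\in\langle h\rangle$). $E(G)$ denotes its edge set (a set of unordered pairs $\{g,h\}$ with $g\neq h$). *)

theory Defs
  imports "HOL-Algebra.Algebra"
begin

definition power_graph_adj :: "('a, 'b) monoid_scheme \<Rightarrow> 'a \<Rightarrow> 'a \<Rightarrow> bool" where
  "power_graph_adj G g h \<longleftrightarrow>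
     g \<in> carrier G \<and> h \<in> carrier G \<and> g \<noteq> h \<and>
     (\<exists>m::nat. m > 0 \<and> (h = g [^]\<^bsub>G\<^esub> m \<or> g = h [^]\<^bsub>G\<^esub> m))"

definition power_graph_edges :: "('a, 'b) monoid_scheme \<Rightarrow> 'a set set" where
  "power_graph_edges G = {{g, h} | g h. power_graph_adj G g h}"

text \<open>In a finite group, positive powers of an element exhaust the cyclic subgroup it generates.\<close>

lemma (in group) power_graph_adj_iff_generate:
  assumes "finite (carrier G)"
  shows "power_graph_adj G g h \<longleftrightarrow>
     g \<in> carrier G \<and> h \<in> carrier G \<and> g \<noteq> h \<and>
     (h \<in> generate G {g} \<or> g \<in> generate G {h})"
proof -
  have *: "y \<in> generate G {x} \<longleftrightarrow> (\<exists>m::nat. m > 0 \<and> y = x [^] m)"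
    if x: "x \<in> carrier G" for x y
  proof
    assume "y \<in> generate G {x}"
    then obtain k :: nat where k: "y = x [^] k"
      using generate_pow_nat[OF x] ord_ge_1[OF assms x] by auto
    have "x [^] (k + ord x) = x [^] k"
      using x by (simp add: nat_pow_mult [symmetric] pow_ord_eq_1)
    moreover have "k + ord x > 0" using ord_ge_1[OF assms x] by simp
    ultimately show "\<exists>m::nat. m > 0 \<and> y = x [^] m" using k by metis
  next
    assume "\<exists>m::nat. m > 0 \<and> y = x [^] m"
    then show "y \<in> generate G {x}"
      using generate_pow_nat[OF x] ord_ge_1[OF assms x] by auto
  qed
  show ?thesis unfolding power_graph_adj_def using * by blast
qed

text \<open>For \<open>n = 0\<close> the library sets \<^term>\<open>integer_mod_group 0 = integer_group\<close>, which is infinite.\<close>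

lemma order_integer_mod_group:
  assumes "n \<ge> 1"
  shows "order (integer_mod_group n) = n"
  using assms by (simp add: order_def carrier_integer_mod_group)

end

theory Submission
  imports Defs "HOL-Number_Theory.Totient"
begin

text \<open>
  Put \<open>f(d) = 2d - \<phi>(d)\<close>. Counting ordered pairs gives \<open>2|E(G)| = \<Sum>\<^sub>g f(ord g) - |G|\<close>, so one has to
  show that \<open>\<Sum>\<^sub>g f(ord g)\<close> is largest for the cyclic group, where it is \<open>\<Sum>\<^sub>d \<phi>(d) f(d)\<close> over \<open>d dvd n\<close>.

  If all orders are at most \<open>\<phi>(n)\<close>, then \<open>f(m)/m \<le> f(n)/n\<close> for \<open>m dvd n\<close> bounds the sum by
  \<open>\<phi>(n) f(n)\<close>, the contribution of the generators of the cyclic group. Otherwise some \<open>x\<close> has order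
  larger than \<open>\<phi>(n) \<ge> n/p\<close>, where \<open>p\<close> is the largest prime factor of \<open>n\<close>. Then \<open>\<langle>x\<rangle>\<close> has index less
  than \<open>p\<close>, hence contains all elements of \<open>p\<close>-power order, and these form a cyclic normal Sylow
  subgroup \<open>P\<close>. A coset of order \<open>m\<close> in \<open>G/P\<close> contains some \<open>g\<close> with \<open>g\<^sup>m = 1\<close>, and \<open>ord (ug)\<close> divides
  \<open>m \<cdot> ord u\<close> for \<open>u \<in> P\<close>; summing over cosets reduces the claim to \<open>G/P\<close>.
\<close>

section \<open>Divisor sums\<close>

text \<open>This is the sum of \<open>h (ord y)\<close> over the elements \<open>y\<close> of a cyclic group of order \<open>n\<close>.\<close>

definition cyclic_sum :: "(nat \<Rightarrow> int) \<Rightarrow> nat \<Rightarrow> int" where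
  "cyclic_sum h n = (\<Sum>d | d dvd n. int (totient d) * h d)"

text \<open>This is the \<open>f\<close> of the overview. The pairs \<open>(g, h)\<close> with
  \<open>h\<close> in the subgroup generated by \<open>g\<close>, together with their reverses,
  contribute \<open>2 * ord g\<close> for each \<open>g\<close>, and \<open>totient (ord g)\<close>
  removes the pairs counted twice.\<close>

definition edge_weight :: "nat \<Rightarrow> int" where
  "edge_weight d = 2 * int d - int (totient d)"

text \<open>The map \<open>c\<close> to \<open>(gcd c a, gcd c b)\<close> is inverse to the
  multiplication of divisors.\<close>

lemma sum_divisors_mult_coprime:
  fixes g :: "nat \<Rightarrow> int"
  assumes "coprime a b" "a > 0" "b > 0"
  shows "(\<Sum>d | d dvd a * b. g d) = (\<Sum>d | d dvd a. \<Sum>e | e dvd b. g (d * e))"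
proof -
  have gcds: "gcd (d * e) a = d \<and> gcd (d * e) b = e" if "d dvd a" "e dvd b" for d e
  proof -
    have "coprime a e" "coprime b d"
      using coprime_divisors[OF dvd_refl that(2) assms(1)] coprime_divisors[OF that(1) dvd_refl assms(1)]
      by (simp_all add: coprime_commute)
    then have "gcd (d * e) a = gcd d a" "gcd (d * e) b = gcd e b"
      by (simp_all add: gcd_mult_left_right_cancel gcd_mult_left_left_cancel)
    then show ?thesis using that by (simp add: gcd_nat.absorb1)
  qed
  have "(\<Sum>d | d dvd a * b. g d) = (\<Sum>(d, e) \<in> {d. d dvd a} \<times> {e. e dvd b}. g (d * e))"
  proof (rule sum.reindex_bij_witness[where i = "\<lambda>(d, e). d * e" and j = "\<lambda>c. (gcd c a, gcd c b)"])
    fix c assume "c \<in> {d. d dvd a * b}"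
    then obtain d e where "c = d * e" "d dvd a" "e dvd b"
      using division_decomp[of c a b] by auto
    then have "gcd c a * gcd c b = c" using gcds by simp
    then show "(case (gcd c a, gcd c b) of (d, e) \<Rightarrow> d * e) = c"
      "(case (gcd c a, gcd c b) of (d, e) \<Rightarrow> g (d * e)) = g c" by auto
  qed (use gcds in \<open>auto simp: mult_dvd_mono\<close>)
  then show ?thesis by (simp add: sum.cartesian_product)
qed

lemma cyclic_sum_mult_coprime:
  assumes "coprime a b" "a > 0" "b > 0"
    and "\<And>d e. coprime d e \<Longrightarrow> h (d * e) = h d * h e"
  shows "cyclic_sum h (a * b) = cyclic_sum h a * cyclic_sum h b"
proof -
  have "cyclic_sum h (a * b) = (\<Sum>d | d dvd a. \<Sum>e | e dvd b. int (totient (d * e)) * h (d * e))"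
    unfolding cyclic_sum_def by (rule sum_divisors_mult_coprime) (use assms in auto)
  also have "\<dots> = (\<Sum>d | d dvd a. \<Sum>e | e dvd b. (int (totient d) * h d) * (int (totient e) * h e))"
  proof (intro sum.cong refl)
    fix d e assume "d \<in> {d. d dvd a}" "e \<in> {e. e dvd b}"
    then have "coprime d e" using assms(1) coprime_divisors by blast
    then show "int (totient (d * e)) * h (d * e) = int (totient d) * h d * (int (totient e) * h e)"
      using assms(4) by (simp add: totient_mult_coprime)
  qed
  finally show ?thesis by (simp add: cyclic_sum_def sum_product)
qed

text \<open>\<open>edge_weight\<close> is not multiplicative, but both functions on the right are,
  so \<open>cyclic_sum_mult_coprime\<close> applies to each of them.\<close>

lemma cyclic_sum_edge_weight:
  "cyclic_sum edge_weight n = 2 * cyclic_sum int n - cyclic_sum (\<lambda>d. int (totient d)) n"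
  by (simp add: cyclic_sum_def edge_weight_def sum_distrib_left sum_subtractf algebra_simps)

lemma cyclic_sum_mono:
  assumes "\<And>d. d dvd n \<Longrightarrow> h d \<le> h' d"
  shows "cyclic_sum h n \<le> cyclic_sum h' n"
  unfolding cyclic_sum_def using assms by (intro sum_mono mult_left_mono) auto

lemma totient_mult_le_cyclic_sum:
  assumes "n > 0" "\<And>d. d dvd n \<Longrightarrow> 0 \<le> h d"
  shows "int (totient n) * h n \<le> cyclic_sum h n"
  unfolding cyclic_sum_def using assms by (intro member_le_sum) auto

section \<open>Inequalities for \<open>edge_weight\<close> and \<open>totient\<close> along
  divisibility\<close>

lemma edge_weight_ge: "int d \<le> edge_weight d"
  using totient_le[of d] by (simp add: edge_weight_def)

lemma edge_weight_le: "edge_weight d \<le> 2 * int d"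
  by (simp add: edge_weight_def)

text \<open>A proper divisor satisfies \<open>2 * m \<le> n\<close>, and
  \<open>edge_weight d\<close> lies between \<open>d\<close> and \<open>2 * d\<close>.\<close>

lemma edge_weight_dvd_mono:
  assumes "m dvd n" "n > 0"
  shows "edge_weight m \<le> edge_weight n"
proof -
  obtain k where k: "n = m * k" using assms by auto
  show ?thesis
  proof (cases "k = 1")
    case False
    with k assms have "k \<ge> 2" by (cases k) auto
    then have "2 * m \<le> n" using k by simp
    then show ?thesis using edge_weight_le[of m] edge_weight_ge[of n] by linarith
  qed (use k in simp)
qed

text \<open>The ratio \<open>totient k / k\<close> is the product of \<open>1 - 1/p\<close> over the
  primes \<open>p\<close> dividing \<open>k\<close>. Passing from \<open>m\<close> to its multiple
  \<open>n\<close> can only add factors, each at most 1.\<close>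

lemma totient_ratio_dvd_antimono:
  assumes "m dvd n" "n > 0"
  shows "totient n * m \<le> n * totient m"
proof -
  have m: "m > 0" using assms by (auto intro: Nat.gr0I)
  have "(\<Prod>p\<in>prime_factors n. 1 - 1 / real p) \<le> (\<Prod>p\<in>prime_factors m. 1 - 1 / real p)"
  proof -
    have sub: "prime_factors m \<subseteq> prime_factors n"
      using assms by (simp add: dvd_prime_factors)
    have "(\<Prod>p\<in>prime_factors n. 1 - 1 / real p) =
        (\<Prod>p\<in>prime_factors n - prime_factors m. 1 - 1 / real p) * (\<Prod>p\<in>prime_factors m. 1 - 1 / real p)"
      by (rule prod.subset_diff[OF sub]) simp
    also have "\<dots> \<le> 1 * (\<Prod>p\<in>prime_factors m. 1 - 1 / real p)"
      by (intro mult_right_mono prod_le_1 prod_nonneg)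
         (auto simp: prime_factors_multiplicity field_simps dest!: prime_gt_0_nat)
    finally show ?thesis by simp
  qed
  then have "real n * real m * (\<Prod>p\<in>prime_factors n. 1 - 1 / real p)
      \<le> real n * real m * (\<Prod>p\<in>prime_factors m. 1 - 1 / real p)"
    by (intro mult_left_mono) auto
  then have "real (totient n * m) \<le> real (n * totient m)"
    by (simp add: totient_formula2 ac_simps)
  then show ?thesis by linarith
qed

lemma edge_weight_ratio_mono:
  assumes "m dvd n" "n > 0"
  shows "int n * edge_weight m \<le> int m * edge_weight n"
proof -
  have "int (totient n * m) \<le> int (n * totient m)"
    using totient_ratio_dvd_antimono[OF assms] by linarith
  then show ?thesis by (simp add: edge_weight_def algebra_simps)
qed

text \<open>The product of the factors \<open>1 - 1/j\<close> over \<open>2 \<le> j \<le> p\<close> telescopes to \<open>1/p\<close>.\<close>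

lemma le_totient_mult_prime:
  assumes "n > 0" "p \<ge> 1" and le: "\<And>q. q \<in> prime_factors n \<Longrightarrow> q \<le> p"
  shows "n \<le> totient n * p"
proof -
  have tele: "(\<Prod>j\<in>{2..k}. 1 - 1 / real j) = 1 / real k" if "k \<ge> 1" for k
    using that by (induction k rule: nat_induct_at_least) (auto simp: field_simps)
  have sub: "prime_factors n \<subseteq> {2..p}"
    using le by (auto simp: prime_factors_multiplicity prime_ge_2_nat)
  have "1 / real p = (\<Prod>j\<in>{2..p} - prime_factors n. 1 - 1 / real j)
      * (\<Prod>j\<in>prime_factors n. 1 - 1 / real j)"
    unfolding tele[OF assms(2), symmetric] by (rule prod.subset_diff[OF sub]) simp
  also have "\<dots> \<le> 1 * (\<Prod>j\<in>prime_factors n. 1 - 1 / real j)"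
    using sub by (intro mult_right_mono prod_le_1 prod_nonneg) (auto simp: field_simps)
  finally have "real n * (1 / real p) \<le> totient n"
    unfolding totient_formula2 by (intro mult_left_mono) auto
  then have "real n \<le> real (totient n * p)" using assms(2) by (simp add: field_simps)
  then show ?thesis by linarith
qed

section \<open>Cyclic subgroups and torsion\<close>

context group begin

lemma pow_eq_pow_iff_cong:
  assumes "x \<in> carrier G"
  shows "x [^] (k::nat) = x [^] (l::nat) \<longleftrightarrow> [k = l] (mod ord x)"
  using int_pow_eq[OF assms, of "int l" "int k"] unfolding int_pow_int
  by (metis cong_iff_dvd_diff cong_int_iff)

lemma generate_singleton_conv_image:
  assumes "x \<in> carrier G" "ord x > 0"
  shows "generate G {x} = (\<lambda>k. x [^] k) ` {0<..ord x}"
proof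
  show "generate G {x} \<subseteq> (\<lambda>k. x [^] k) ` {0<..ord x}"
  proof
    fix y assume "y \<in> generate G {x}"
    then obtain k :: nat where k: "y = x [^] k"
      using generate_pow_nat assms by auto
    \<comment> \<open>The exponents run from 1 to \<open>ord x\<close>, so the residue 0 is
      represented by \<open>ord x\<close>.\<close>
    define r where "r = (if k mod ord x = 0 then ord x else k mod ord x)"
    have "r \<in> {0<..ord x}" using assms(2) by (simp add: r_def less_imp_le)
    moreover have "y = x [^] r"
      unfolding k pow_eq_pow_iff_cong[OF assms(1)] by (simp add: r_def cong_def)
    ultimately show "y \<in> (\<lambda>k. x [^] k) ` {0<..ord x}" by blast
  qed
  show "(\<lambda>k. x [^] k) ` {0<..ord x} \<subseteq> generate G {x}"
    using generate_pow_nat assms by auto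
qed

text \<open>Group the exponents \<open>k\<close> by \<open>d = gcd k (ord x)\<close>: there are
  \<open>totient (ord x div d)\<close> of them, and each gives an element of order
  \<open>ord x div d\<close>.\<close>

lemma sum_ord_generate:
  assumes x: "x \<in> carrier G" and pos: "ord x > 0"
  shows "(\<Sum>y\<in>generate G {x}. h (ord y)) = cyclic_sum h (ord x)"
proof -
  let ?n = "ord x"
  have "inj_on (\<lambda>k. x [^] k) {0<..?n}"
    by (rule eq_card_imp_inj_on) (use generate_pow_card[OF x] generate_singleton_conv_image[OF assms] in auto)
  then have "(\<Sum>y\<in>generate G {x}. h (ord y)) = (\<Sum>k\<in>{0<..?n}. h (ord (x [^] k)))"
    unfolding generate_singleton_conv_image[OF assms] by (simp add: sum.reindex)
  also have "\<dots> = (\<Sum>k\<in>{0<..?n}. h (?n div gcd k ?n))"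
    using x by (intro sum.cong) (auto simp: ord_pow_gen gcd.commute)
  also have "\<dots> = (\<Sum>d | d dvd ?n. \<Sum>k | k \<in> {0<..?n} \<and> gcd k ?n = d. h (?n div gcd k ?n))"
    by (rule sum.group [symmetric]) (use pos in auto)
  also have "\<dots> = (\<Sum>d | d dvd ?n. int (totient (?n div d)) * h (?n div d))"
    by (intro sum.cong refl) (use pos card_gcd_eq_totient in simp)
  also have "\<dots> = cyclic_sum h ?n"
    unfolding cyclic_sum_def
    by (rule sum.reindex_bij_witness[where i = "\<lambda>d. ?n div d" and j = "\<lambda>d. ?n div d"])
       (use pos in auto)
  finally show ?thesis .
qed

text \<open>Two of the products \<open>y\<^sup>i x\<^sup>j\<close> with \<open>i < p\<close> and \<open>j < ord x\<close> coincide,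
  so some \<open>y\<^sup>t\<close> with \<open>0 < t < p\<close> is a power of \<open>x\<close>, and \<open>t\<close> is invertible modulo the order of \<open>y\<close>.\<close>

lemma prime_power_torsion_in_generate:
  assumes fin: "finite (carrier G)" and x: "x \<in> carrier G" and y: "y \<in> carrier G"
    and p: "Factorial_Ring.prime p" and yq: "y [^] (p ^ a) = \<one>" and big: "order G < p * ord x"
  shows "y \<in> generate G {x}"
proof -
  let ?H = "generate G {x}"
  have H: "subgroup ?H G" using x by (simp add: generate_is_subgroup)
  have ordx: "ord x > 0" using ord_ge_1[OF fin x] by simp
  have powH: "x [^] (j::nat) \<in> ?H" for j
    using generate_pow_nat[OF x] ordx by auto
  let ?f = "\<lambda>(i::nat, j::nat). y [^] i \<otimes> x [^] j"
  have "?f ` ({..<p} \<times> {..<ord x}) \<subseteq> carrier G" using x y by auto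
  then have "card (?f ` ({..<p} \<times> {..<ord x})) \<le> order G"
    unfolding order_def by (rule card_mono[OF fin])
  also have "\<dots> < card ({..<p} \<times> {..<ord x})"
    using big by (simp add: card_cartesian_product)
  finally have "card (?f ` ({..<p} \<times> {..<ord x})) < card ({..<p} \<times> {..<ord x})" .
  then have "\<not> inj_on ?f ({..<p} \<times> {..<ord x})"
    by (rule pigeonhole)
  then obtain i j i' j' where ij: "i < p" "i' < p" "j < ord x" "j' < ord x"
      "(i, j) \<noteq> (i', j')" and eq: "y [^] i \<otimes> x [^] j = y [^] i' \<otimes> x [^] j'"
    by (auto simp: inj_on_def)
  have diff: "y [^] (v - u) \<in> ?H"
    if "u < v" and "y [^] u \<otimes> x [^] k = y [^] v \<otimes> x [^] l" for u v k l :: nat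
  proof -
    have "y [^] u \<otimes> x [^] k = y [^] u \<otimes> (y [^] (v - u) \<otimes> x [^] l)"
      using that x y by (simp add: m_assoc [symmetric] nat_pow_mult)
    then have "x [^] k = y [^] (v - u) \<otimes> x [^] l" using x y by simp
    then have "y [^] (v - u) = x [^] k \<otimes> inv (x [^] l)"
      using x y by (simp add: inv_solve_right)
    then show ?thesis
      using powH H by (simp add: subgroup.m_closed subgroup.m_inv_closed)
  qed
  have "i \<noteq> i'"
  proof
    assume "i = i'"
    then have "x [^] j = x [^] j'" using eq x y by simp
    then have "j = j'" using ord_inj[OF x] ij by (auto simp: inj_on_def)
    then show False using ij \<open>i = i'\<close> by simp
  qed
  then obtain t where t: "0 < t" "t < p" "y [^] t \<in> ?H"
  proof (cases "i < i'")
    case True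
    then show ?thesis using that[of "i' - i"] diff[OF True eq] ij by simp
  next
    case False
    then have "i' < i" using \<open>i \<noteq> i'\<close> by simp
    then show ?thesis using that[of "i - i'"] diff[OF _ eq [symmetric]] ij by simp
  qed
  have "coprime t (p ^ a)"
    using t p by (metis coprime_commute coprime_power_right_iff prime_imp_coprime nat_dvd_not_less)
  then obtain s where s: "[t * s = 1] (mod p ^ a)"
    using cong_solve_coprime_nat[of t "p ^ a"] by auto
  have "ord y dvd p ^ a" using y yq by (simp add: pow_eq_id)
  then have "[t * s = 1] (mod ord y)" using s cong_dvd_modulus_nat by blast
  then have "(y [^] t) [^] s = y [^] (1::nat)"
    using y by (simp only: nat_pow_pow pow_eq_pow_iff_cong)
  moreover have "(y [^] t) [^] s \<in> ?H"
    using subgroup_int_pow_closed[OF H t(3), of "int s"] by (simp add: int_pow_int)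
  ultimately show ?thesis using y by simp
qed

section \<open>Torsion sets, their cosets and quotients\<close>

text \<open>In general this is not a subgroup. If \<open>d\<close> is the full power of a prime
  dividing the order of a finite group, it is the union of the Sylow subgroups for that
  prime.\<close>

definition torsion :: "nat \<Rightarrow> 'a set" where
  "torsion d = {y \<in> carrier G. y [^] d = \<one>}"

lemma mem_torsion_iff: "y \<in> torsion d \<longleftrightarrow> y \<in> carrier G \<and> ord y dvd d"
  by (auto simp: torsion_def pow_eq_id)

lemma nat_pow_conj:
  assumes "g \<in> carrier G" "y \<in> carrier G"
  shows "(g \<otimes> y \<otimes> inv g) [^] (k::nat) = g \<otimes> y [^] k \<otimes> inv g"
proof (induction k)
  case (Suc k)
  have "(g \<otimes> y [^] k \<otimes> inv g) \<otimes> (g \<otimes> y \<otimes> inv g) = g \<otimes> y [^] k \<otimes> (inv g \<otimes> g) \<otimes> (y \<otimes> inv g)"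
    using assms by (simp only: m_assoc m_closed inv_closed nat_pow_closed)
  also have "\<dots> = g \<otimes> (y [^] k \<otimes> y) \<otimes> inv g"
    using assms by (simp add: m_assoc)
  finally show ?case using Suc by simp
qed (use assms in simp)

text \<open>Commutation lets powers distribute over products, which gives closure; conjugation
  commutes with powers, which gives normality.\<close>

lemma torsion_normal:
  assumes comm: "\<And>y z. y \<in> torsion d \<Longrightarrow> z \<in> torsion d \<Longrightarrow> y \<otimes> z = z \<otimes> y"
  shows "torsion d \<lhd> G"
  unfolding normal_inv_iff
proof (intro conjI ballI)
  show "subgroup (torsion d) G"
  proof (rule subgroupI)
    show "torsion d \<noteq> {}" by (auto simp: torsion_def intro!: exI[of _ \<one>])
  next
    fix y z assume "y \<in> torsion d" "z \<in> torsion d"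
    with comm[OF this] show "y \<otimes> z \<in> torsion d"
      by (auto simp: torsion_def pow_mult_distrib)
  qed (auto simp: torsion_def nat_pow_inv)
  show "x \<otimes> h \<otimes> inv x \<in> torsion d" if "x \<in> carrier G" "h \<in> torsion d" for x h
    using that by (auto simp: torsion_def nat_pow_conj)
qed

text \<open>Modulo \<open>torsion d\<close> the elements \<open>u \<otimes> g\<close> and
  \<open>g\<close> agree, so the \<open>m\<close>-th power of \<open>u \<otimes> g\<close> falls
  into \<open>torsion d\<close> and is killed by \<open>d\<close>.\<close>

lemma pow_mult_torsion_eq_one:
  assumes N: "torsion d \<lhd> G" and u: "u \<in> torsion d"
    and g: "g \<in> carrier G" "g [^] (m::nat) = \<one>"
  shows "(u \<otimes> g) [^] (m * d) = \<one>"
proof -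
  interpret N: normal "torsion d" G by (rule N)
  have uc: "u \<in> carrier G" using u by (rule N.mem_carrier)
  have "torsion d #> (u \<otimes> g) = torsion d #> g"
    using coset_mult_assoc[OF N.subset uc g(1)] coset_join2[OF uc N.is_subgroup u] by simp
  then have "torsion d #> ((u \<otimes> g) [^] m) = torsion d #> (g [^] m)"
    using N.FactGroup_pow[of "u \<otimes> g" m] N.FactGroup_pow[of g m] uc g by simp
  then have "torsion d #> ((u \<otimes> g) [^] m) = torsion d"
    using g N.subset by simp
  then have "(u \<otimes> g) [^] m \<in> torsion d"
    using rcos_self[OF _ N.is_subgroup, of "(u \<otimes> g) [^] m"] uc g by simp
  then have "((u \<otimes> g) [^] m) [^] d = \<one>" unfolding torsion_def by blast
  then show ?thesis using uc g by (simp add: nat_pow_pow)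
qed

text \<open>Raise any representative to a power that is \<open>0\<close> modulo \<open>q\<close> and \<open>1\<close> modulo the order of the coset.\<close>

lemma torsion_coset_representative:
  assumes N: "torsion q \<lhd> G" and cop: "coprime q (order (G Mod torsion q))"
    and v: "v \<in> carrier (G Mod torsion q)"
  obtains g where "g \<in> carrier G" "v = torsion q #> g"
    "g [^] (group.ord (G Mod torsion q) v) = \<one>"
proof -
  interpret N: normal "torsion q" G by (rule N)
  interpret F: group "G Mod torsion q" by (rule N.factorgroup_is_group)
  obtain g0 where g0: "g0 \<in> carrier G" "v = torsion q #> g0"
    using v by (auto simp: carrier_FactGroup)
  define m where "m = F.ord v"
  have "torsion q #> (g0 [^] m) = torsion q"
    using F.pow_ord_eq_1[OF v] g0 by (simp add: m_def N.FactGroup_pow)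
  then have "g0 [^] m \<in> torsion q"
    using rcos_self[OF _ N.is_subgroup, of "g0 [^] m"] g0 by simp
  then have "(g0 [^] m) [^] q = \<one>" unfolding torsion_def by blast
  then have g0mq: "g0 [^] (m * q) = \<one>" using g0 by (simp add: nat_pow_pow)
  have "coprime q m"
    using cop F.ord_dvd_group_order[OF v] unfolding m_def by (metis coprime_divisors dvd_refl)
  then obtain s where s: "[q * s = 1] (mod m)"
    using cong_solve_coprime_nat[of q m] by auto
  show ?thesis
  proof
    show "g0 [^] (q * s) \<in> carrier G" using g0 by simp
    have "v [^]\<^bsub>G Mod torsion q\<^esub> (q * s) = v [^]\<^bsub>G Mod torsion q\<^esub> (1::nat)"
      using s v by (simp only: F.pow_eq_pow_iff_cong m_def)
    also have "\<dots> = v" using v by (rule F.nat_pow_eone)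
    finally show "v = torsion q #> (g0 [^] (q * s))"
      using g0 by (simp add: N.FactGroup_pow)
    have "(g0 [^] (q * s)) [^] m = (g0 [^] (m * q)) [^] s"
      using g0 by (simp add: nat_pow_pow ac_simps)
    then show "(g0 [^] (q * s)) [^] F.ord v = \<one>" using g0mq by (simp add: m_def)
  qed
qed

lemma sum_ord_coset_le:
  fixes h :: "nat \<Rightarrow> int"
  assumes fin: "finite (carrier G)" and q: "q > 0"
    and N: "\<And>d. d dvd q \<Longrightarrow> torsion d \<lhd> G"
    and cop: "coprime q (order (G Mod torsion q))"
    and v: "v \<in> carrier (G Mod torsion q)"
    and mono: "\<And>i j. i dvd j \<Longrightarrow> j > 0 \<Longrightarrow> h i \<le> h j"
  shows "(\<Sum>y\<in>v. h (ord y)) \<le> (\<Sum>u\<in>torsion q. h (group.ord (G Mod torsion q) v * ord u))"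
proof -
  interpret N: normal "torsion q" G by (rule N) simp
  interpret F: group "G Mod torsion q" by (rule N.factorgroup_is_group)
  obtain g where g: "g \<in> carrier G" "v = torsion q #> g" "g [^] F.ord v = \<one>"
    using torsion_coset_representative[OF N cop v] by auto
  have finF: "finite (carrier (G Mod torsion q))" using fin by (simp add: carrier_FactGroup)
  have v_img: "v = (\<lambda>u. u \<otimes> g) ` torsion q" using g(2) by (auto simp: r_coset_def)
  have inj: "inj_on (\<lambda>u. u \<otimes> g) (torsion q)"
  proof (rule inj_onI)
    fix u w assume "u \<in> torsion q" "w \<in> torsion q" "u \<otimes> g = w \<otimes> g"
    then show "u = w" using g(1) N.mem_carrier right_cancel by blast
  qed
  have "(\<Sum>y\<in>v. h (ord y)) = (\<Sum>u\<in>torsion q. h (ord (u \<otimes> g)))"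
    by (subst v_img) (simp add: sum.reindex[OF inj])
  also have "\<dots> \<le> (\<Sum>u\<in>torsion q. h (F.ord v * ord u))"
  proof (intro sum_mono mono)
    fix u assume u: "u \<in> torsion q"
    then have uc: "u \<in> carrier G" "ord u dvd q" unfolding mem_torsion_iff by blast+
    \<comment> \<open>Working with \<open>torsion (ord u)\<close> instead of
      \<open>torsion q\<close> gives the sharp bound \<open>F.ord v * ord u\<close> in place of
      \<open>F.ord v * q\<close>. For this, normality is assumed for every divisor of
      \<open>q\<close>.\<close>
    then have "u \<in> torsion (ord u)" unfolding mem_torsion_iff by simp
    from pow_mult_torsion_eq_one[OF N[OF uc(2)] this g(1,3)]
    show "ord (u \<otimes> g) dvd F.ord v * ord u" using uc g by (simp add: pow_eq_id)
    show "F.ord v * ord u > 0"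
      using F.ord_ge_1[OF finF v] ord_ge_1[OF fin uc(1)] by simp
  qed
  finally show ?thesis .
qed

text \<open>The cosets of \<open>torsion q\<close> partition the group. Since
  \<open>torsion q\<close> is cyclic of order \<open>q\<close>, the bound on each coset is a divisor
  sum.\<close>

lemma sum_ord_le_quotient:
  fixes h :: "nat \<Rightarrow> int"
  assumes fin: "finite (carrier G)" and q: "q > 0"
    and N: "\<And>d. d dvd q \<Longrightarrow> torsion d \<lhd> G"
    and cop: "coprime q (order (G Mod torsion q))"
    and c: "c \<in> carrier G" "ord c = q" "torsion q = generate G {c}"
    and mono: "\<And>i j. i dvd j \<Longrightarrow> j > 0 \<Longrightarrow> h i \<le> h j"
  shows "(\<Sum>y\<in>carrier G. h (ord y)) \<le>
    (\<Sum>v\<in>carrier (G Mod torsion q). cyclic_sum (\<lambda>d. h (group.ord (G Mod torsion q) v * d)) q)"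
proof -
  interpret N: normal "torsion q" G by (rule N) simp
  have carr: "carrier (G Mod torsion q) = rcosets (torsion q)" by (simp add: FactGroup_def)
  have "(\<Sum>y\<in>carrier G. h (ord y)) = (\<Sum>y\<in>\<Union>(rcosets (torsion q)). h (ord y))"
    by (simp add: rcosets_part_G N.is_subgroup)
  also have "\<dots> = (\<Sum>v\<in>rcosets (torsion q). \<Sum>y\<in>v. h (ord y))"
  proof -
    have "\<forall>v\<in>rcosets (torsion q). finite v"
      using cosets_finite[OF _ N.subset fin] by blast
    moreover have "\<forall>v\<in>rcosets (torsion q). \<forall>w\<in>rcosets (torsion q). v \<noteq> w \<longrightarrow> v \<inter> w = {}"
      using rcos_disjoint[OF N.is_subgroup] by (auto simp: pairwise_def disjnt_def)
    ultimately show ?thesis by (simp add: sum.Union_disjoint)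
  qed
  also have "\<dots> \<le> (\<Sum>v\<in>rcosets (torsion q). cyclic_sum (\<lambda>d. h (group.ord (G Mod torsion q) v * d)) q)"
  proof (rule sum_mono)
    fix v assume "v \<in> rcosets (torsion q)"
    then have "(\<Sum>y\<in>v. h (ord y)) \<le> (\<Sum>u\<in>torsion q. h (group.ord (G Mod torsion q) v * ord u))"
      using sum_ord_coset_le[OF fin q N cop _ mono, of v] by (simp add: carr)
    also have "\<dots> = cyclic_sum (\<lambda>d. h (group.ord (G Mod torsion q) v * d)) q"
      using sum_ord_generate[OF c(1)] c(2,3) q by simp
    finally show "(\<Sum>y\<in>v. h (ord y)) \<le> cyclic_sum (\<lambda>d. h (group.ord (G Mod torsion q) v * d)) q" .
  qed
  finally show ?thesis by (simp add: carr)
qed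

text \<open>The subgroup generated by \<open>x\<close> contains every \<open>torsion d\<close> in
  question, so these elements commute, and \<open>torsion (p ^ a)\<close> inherits cyclicity from
  it.\<close>

lemma cyclic_normal_torsion:
  assumes fin: "finite (carrier G)" and x: "x \<in> carrier G"
    and p: "Factorial_Ring.prime p" and big: "order G < p * ord x"
    and n: "order G = p ^ a * r"
  obtains c where "c \<in> carrier G" "ord c = p ^ a" "torsion (p ^ a) = generate G {c}"
    "\<And>d. d dvd p ^ a \<Longrightarrow> torsion d \<lhd> G"
proof -
  let ?q = "p ^ a"
  have q0: "?q > 0" using p by (simp add: prime_gt_0_nat)
  have npos: "order G > 0" using fin by (simp add: order_gt_0_iff_finite)
  have ordx: "ord x > 0" using ord_ge_1[OF fin x] by simp
  have gen: "generate G {x} = {x [^] k |k. k \<in> (UNIV::nat set)}"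
    using generate_pow_nat[OF x] ordx by simp
  have sub: "torsion d \<subseteq> generate G {x}" if "d dvd ?q" for d
    using prime_power_torsion_in_generate[OF fin x _ p _ big, of _ a] that
    by (auto simp: torsion_def pow_eq_id)
  \<comment> \<open>\<open>k\<close> is the index of the subgroup generated by \<open>x\<close>.
    Being smaller than \<open>p\<close>, it is coprime to \<open>p ^ a\<close>, so the whole factor
    \<open>p ^ a\<close> divides \<open>ord x\<close>.\<close>
  obtain k where k: "order G = ord x * k" using ord_dvd_group_order[OF x] by auto
  have "k > 0" using npos k by (auto intro: Nat.gr0I)
  have "k < p" using big k ordx by simp
  then have "coprime ?q k"
    using \<open>k > 0\<close> p by (metis coprime_power_left_iff prime_imp_coprime nat_dvd_not_less)
  moreover have "?q dvd ord x * k" using n k by (metis dvd_triv_left)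
  ultimately have qx: "?q dvd ord x" by (simp add: coprime_dvd_mult_left_iff)
  define l where "l = ord x div ?q"
  have l: "ord x = l * ?q" using qx by (simp add: l_def)
  then have "l > 0" using ordx by (auto intro: Nat.gr0I)
  define c where "c = x [^] l"
  have c: "c \<in> carrier G" using x by (simp add: c_def)
  have "ord c = ord x div l"
    unfolding c_def using x l \<open>l > 0\<close> by (intro ord_pow) auto
  then have ordc: "ord c = ?q" using l \<open>l > 0\<close> by simp
  have genc: "generate G {c} = {c [^] k |k. k \<in> (UNIV::nat set)}"
    using generate_pow_nat[OF c] ordc q0 by simp
  show ?thesis
  proof
    show "c \<in> carrier G" "ord c = ?q" by fact+
    show "torsion ?q = generate G {c}"
    proof
      show "torsion ?q \<subseteq> generate G {c}"
      proof
        fix y assume y: "y \<in> torsion ?q"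
        then obtain j :: nat where j: "y = x [^] j" using sub[of ?q] gen by auto
        then have "ord x dvd j * ?q" using y x by (simp add: torsion_def nat_pow_pow pow_eq_id)
        then have "l dvd j" using l q0 by (metis dvd_times_right_cancel_iff not_gr_zero)
        then obtain i where "j = l * i" by auto
        then have "y = c [^] i" using x by (simp add: j c_def nat_pow_pow)
        then show "y \<in> generate G {c}" unfolding genc by blast
      qed
      show "generate G {c} \<subseteq> torsion ?q"
        using c ordc by (auto simp: genc torsion_def nat_pow_pow pow_eq_id)
    qed
    show "torsion d \<lhd> G" if d: "d dvd ?q" for d
    proof (rule torsion_normal)
      fix y z assume "y \<in> torsion d" "z \<in> torsion d"
      then obtain i j :: nat where "y = x [^] i" "z = x [^] j"
        using sub[OF d] gen by blast
      then show "y \<otimes> z = z \<otimes> y" using x by (simp add: nat_pow_mult add.commute)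
    qed
  qed
qed

end

section \<open>Sums over element orders\<close>

lemma ord_iso:
  assumes "group G" "group H" "\<phi> \<in> iso G H" "x \<in> carrier G"
  shows "group.ord H (\<phi> x) = group.ord G x"
proof -
  interpret G: group G by fact
  interpret H: group H by fact
  interpret \<phi>: group_hom G H \<phi>
    using assms by (simp add: group_hom_def group_hom_axioms_def iso_def)
  have "inj_on \<phi> (carrier G)" using assms(3) by (simp add: iso_def bij_betw_def)
  then have "\<phi> x [^]\<^bsub>H\<^esub> k = \<one>\<^bsub>H\<^esub> \<longleftrightarrow> x [^]\<^bsub>G\<^esub> k = \<one>\<^bsub>G\<^esub>" for k :: nat
    using assms(4) by (metis G.nat_pow_closed G.one_closed \<phi>.hom_nat_pow \<phi>.hom_one inj_on_eq_iff)
  then show ?thesis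
    using assms(4) by (simp add: H.ord_unique G.pow_eq_id)
qed

text \<open>The bound for \<open>edge_weight\<close> alone does not pass from a quotient to the group: the
  multiplicativity defect of \<open>edge_weight\<close> is controlled by the plain sum of element orders.\<close>

definition order_sums_bounded :: "('a, 'b) monoid_scheme \<Rightarrow> bool" where
  "order_sums_bounded G \<longleftrightarrow>
     (\<Sum>x\<in>carrier G. int (group.ord G x)) \<le> cyclic_sum int (order G) \<and>
     (\<Sum>x\<in>carrier G. edge_weight (group.ord G x)) \<le> cyclic_sum edge_weight (order G)"

lemma order_sums_bounded_iso:
  assumes "group G" "group H" "\<phi> \<in> iso G H" "order_sums_bounded H"
  shows "order_sums_bounded G"
proof -
  have bij: "bij_betw \<phi> (carrier G) (carrier H)" using assms(3) by (simp add: iso_def)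
  have "(\<Sum>x\<in>carrier H. h (group.ord H x)) = (\<Sum>x\<in>carrier G. h (group.ord G x))" for h :: "nat \<Rightarrow> int"
    unfolding sum.reindex_bij_betw[OF bij, symmetric]
    by (intro sum.cong refl) (simp add: ord_iso[OF assms(1-3)])
  moreover have "order H = order G" using bij by (simp add: order_def bij_betw_same_card)
  ultimately show ?thesis using assms(4) by (simp add: order_sums_bounded_def)
qed

section \<open>Induction on the group order\<close>

context group begin

text \<open>Each sum is bounded already by the term for the divisor \<open>order G\<close> of the
  corresponding cyclic sum.\<close>

lemma order_sums_bounded_if_small_ords:
  assumes fin: "finite (carrier G)"
    and small: "\<And>x. x \<in> carrier G \<Longrightarrow> ord x \<le> totient (order G)"
  shows "order_sums_bounded G"
proof -
  let ?n = "order G"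
  have n: "?n > 0" using fin by (simp add: order_gt_0_iff_finite)
  have card: "int (card (carrier G)) = int ?n" by (simp add: order_def)
  have "(\<Sum>x\<in>carrier G. int (ord x)) \<le> (\<Sum>x\<in>carrier G. int (totient ?n))"
    using small by (intro sum_mono) auto
  also have "\<dots> = int (totient ?n) * int ?n" by (simp add: card)
  also have "\<dots> \<le> cyclic_sum int ?n"
    by (rule totient_mult_le_cyclic_sum) (use n in auto)
  finally have 1: "(\<Sum>x\<in>carrier G. int (ord x)) \<le> cyclic_sum int ?n" by simp
  have w: "0 \<le> edge_weight d" for d using edge_weight_ge[of d] by linarith
  \<comment> \<open>Scaling by the group order replaces the comparison of the ratios
    \<open>edge_weight d / d\<close> by one without fractions.\<close>
  have "int ?n * (\<Sum>x\<in>carrier G. edge_weight (ord x)) = (\<Sum>x\<in>carrier G. int ?n * edge_weight (ord x))"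
    by (simp add: sum_distrib_left)
  also have "\<dots> \<le> (\<Sum>x\<in>carrier G. int (totient ?n) * edge_weight ?n)"
  proof (rule sum_mono)
    fix x assume x: "x \<in> carrier G"
    have "int ?n * edge_weight (ord x) \<le> int (ord x) * edge_weight ?n"
      using ord_dvd_group_order[OF x] n by (rule edge_weight_ratio_mono)
    also have "\<dots> \<le> int (totient ?n) * edge_weight ?n"
      using small[OF x] w by (intro mult_right_mono) auto
    finally show "int ?n * edge_weight (ord x) \<le> int (totient ?n) * edge_weight ?n" by simp
  qed
  also have "\<dots> = int ?n * (int (totient ?n) * edge_weight ?n)" by (simp add: card)
  finally have "(\<Sum>x\<in>carrier G. edge_weight (ord x)) \<le> int (totient ?n) * edge_weight ?n"
    using n by simp
  also have "\<dots> \<le> cyclic_sum edge_weight ?n"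
    by (rule totient_mult_le_cyclic_sum) (use n w in auto)
  finally show ?thesis using 1 by (simp add: order_sums_bounded_def)
qed

text \<open>For coprime \<open>m\<close> and \<open>d\<close>, \<open>edge_weight (m * d) =
  edge_weight m * totient d + 2 * m * (d - totient d)\<close>. Summing over \<open>d\<close> gives a
  combination of \<open>edge_weight m\<close> and \<open>m\<close> with nonnegative coefficients, so
  both bounds for the quotient enter.\<close>

lemma order_sums_bounded_quotient:
  assumes fin: "finite (carrier G)" and q: "q > 0"
    and N: "\<And>d. d dvd q \<Longrightarrow> torsion d \<lhd> G"
    and cop: "coprime q (order (G Mod torsion q))"
    and c: "c \<in> carrier G" "ord c = q" "torsion q = generate G {c}"
    and Q: "order_sums_bounded (G Mod torsion q)"
  shows "order_sums_bounded G"
proof -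
  interpret N: normal "torsion q" G by (rule N) simp
  interpret F: group "G Mod torsion q" by (rule N.factorgroup_is_group)
  let ?F = "carrier (G Mod torsion q)" and ?r = "order (G Mod torsion q)"
  let ?A = "cyclic_sum int" and ?B = "cyclic_sum (\<lambda>d. int (totient d))"
  have card_q: "card (torsion q) = q" using c generate_pow_card[OF c(1)] by simp
  have n: "order G = q * ?r"
    using lagrange[OF N.is_subgroup] by (simp add: card_q order_def FactGroup_def mult.commute)
  have r: "?r > 0" using n fin by (metis mult_is_0 not_gr_zero order_gt_0_iff_finite)
  have mult: "?A (order G) = ?A q * ?A ?r" "?B (order G) = ?B q * ?B ?r"
    unfolding n by (intro cyclic_sum_mult_coprime cop q r; simp add: totient_mult_coprime)+
  have "(\<Sum>y\<in>carrier G. int (ord y)) \<le> (\<Sum>v\<in>?F. cyclic_sum (\<lambda>d. int (F.ord v * d)) q)"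
    by (rule sum_ord_le_quotient[OF fin q N cop c]) (simp_all add: dvd_imp_le)
  also have "\<dots> = (\<Sum>v\<in>?F. int (F.ord v)) * ?A q"
    by (simp add: cyclic_sum_def sum_distrib_left sum_distrib_right ac_simps)
  also have "\<dots> \<le> ?A ?r * ?A q"
    using Q by (intro mult_right_mono) (auto simp: order_sums_bounded_def cyclic_sum_def intro: sum_nonneg)
  finally have 1: "(\<Sum>y\<in>carrier G. int (ord y)) \<le> ?A (order G)"
    by (simp add: mult(1) ac_simps)
  have "(\<Sum>y\<in>carrier G. edge_weight (ord y)) \<le> (\<Sum>v\<in>?F. cyclic_sum (\<lambda>d. edge_weight (F.ord v * d)) q)"
    by (rule sum_ord_le_quotient[OF fin q N cop c edge_weight_dvd_mono])
  also have "\<dots> = (\<Sum>v\<in>?F. edge_weight (F.ord v) * ?B q + int (F.ord v) * (2 * (?A q - ?B q)))"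
  proof (rule sum.cong [OF refl])
    fix v assume v: "v \<in> ?F"
    have "cyclic_sum (\<lambda>d. edge_weight (F.ord v * d)) q =
        (\<Sum>d | d dvd q. edge_weight (F.ord v) * (int (totient d) * int (totient d))
          + int (F.ord v) * (2 * (int (totient d) * int d - int (totient d) * int (totient d))))"
      unfolding cyclic_sum_def
    proof (rule sum.cong [OF refl])
      fix d assume "d \<in> {d. d dvd q}"
      then have "coprime (F.ord v) d"
        using cop F.ord_dvd_group_order[OF v] by (metis coprime_commute coprime_divisors mem_Collect_eq)
      then have "totient (F.ord v * d) = totient (F.ord v) * totient d"
        by (rule totient_mult_coprime)
      then show "int (totient d) * edge_weight (F.ord v * d) =
          edge_weight (F.ord v) * (int (totient d) * int (totient d))
          + int (F.ord v) * (2 * (int (totient d) * int d - int (totient d) * int (totient d)))"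
        by (simp add: edge_weight_def algebra_simps)
    qed
    also have "\<dots> = edge_weight (F.ord v) * ?B q + int (F.ord v) * (2 * (?A q - ?B q))"
      by (simp add: cyclic_sum_def sum.distrib sum_subtractf flip: sum_distrib_left)
    finally show "cyclic_sum (\<lambda>d. edge_weight (F.ord v * d)) q =
        edge_weight (F.ord v) * ?B q + int (F.ord v) * (2 * (?A q - ?B q))" .
  qed
  also have "\<dots> = (\<Sum>v\<in>?F. edge_weight (F.ord v)) * ?B q + (\<Sum>v\<in>?F. int (F.ord v)) * (2 * (?A q - ?B q))"
    by (simp add: sum.distrib sum_distrib_right)
  also have "\<dots> \<le> cyclic_sum edge_weight ?r * ?B q + ?A ?r * (2 * (?A q - ?B q))"
  proof (intro add_mono mult_right_mono)
    show "0 \<le> ?B q" by (auto simp: cyclic_sum_def intro: sum_nonneg)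
    have "?B q \<le> ?A q" by (rule cyclic_sum_mono) (simp add: totient_le)
    then show "0 \<le> 2 * (?A q - ?B q)" by simp
  qed (use Q in \<open>simp_all add: order_sums_bounded_def\<close>)
  \<comment> \<open>Nothing is lost here: with \<open>A\<close> and \<open>B\<close> multiplicative,
    both sides equal \<open>2 * ?A q * ?A ?r - ?B q * ?B ?r\<close>.\<close>
  also have "\<dots> = cyclic_sum edge_weight (order G)"
    by (simp add: cyclic_sum_edge_weight mult algebra_simps)
  finally show ?thesis using 1 by (simp add: order_sums_bounded_def)
qed

text \<open>The case split is whether some element has order above \<open>totient (order G)\<close>.
  The induction hypothesis covers only groups over the element type \<open>'a\<close>, since a type
  cannot vary inside an assumption.\<close>

lemma order_sums_bounded_step:
  assumes fin: "finite (carrier G)"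
    and IH: "\<And>H :: 'a monoid. group H \<Longrightarrow> finite (carrier H) \<Longrightarrow> order H < order G \<Longrightarrow> order_sums_bounded H"
  shows "order_sums_bounded G"
proof (cases "\<forall>x\<in>carrier G. ord x \<le> totient (order G)")
  case True
  then show ?thesis using order_sums_bounded_if_small_ords[OF fin] by blast
next
  case False
  let ?n = "order G"
  have n: "?n > 0" using fin by (simp add: order_gt_0_iff_finite)
  from False obtain x where x: "x \<in> carrier G" "totient ?n < ord x" by auto
  have "?n \<noteq> 1" using x ord_le_group_order[OF fin x(1)] by auto
  then have ne: "prime_factors ?n \<noteq> {}" using n by (auto simp: prime_factorization_empty_iff)
  \<comment> \<open>Taking the largest prime factor makes \<open>le_totient_mult_prime\<close>
    applicable, which turns \<open>totient ?n < ord x\<close> into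
    \<open>?n < p * ord x\<close>.\<close>
  define p where "p = Max (prime_factors ?n)"
  have pin: "p \<in> prime_factors ?n" unfolding p_def using ne by (intro Max_in) auto
  then have p: "Factorial_Ring.prime p" "p dvd ?n" by auto
  have "?n \<le> totient ?n * p"
    using n prime_ge_1_nat[OF p(1)] by (intro le_totient_mult_prime) (auto simp: p_def)
  also have "\<dots> < p * ord x" using x(2) p(1) by (simp add: prime_gt_0_nat)
  finally have big: "?n < p * ord x" .
  define a where "a = multiplicity p ?n"
  obtain r where r: "?n = p ^ a * r" "\<not> p dvd r"
    using multiplicity_decompose'[of ?n p] n p(1) unfolding a_def
    by (metis less_numeral_extra(3) not_prime_unit)
  \<comment> \<open>Positivity of \<open>a\<close> makes the quotient strictly smaller than
    \<open>G\<close>.\<close>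
  have a: "a > 0" using p n by (simp add: a_def prime_multiplicity_gt_zero_iff)
  obtain c where c: "c \<in> carrier G" "ord c = p ^ a" "torsion (p ^ a) = generate G {c}"
    and N: "\<And>d. d dvd p ^ a \<Longrightarrow> torsion d \<lhd> G"
    using cyclic_normal_torsion[OF fin x(1) p(1) big r(1)] by blast
  let ?T = "torsion (p ^ a)"
  interpret N: normal ?T G by (rule N) simp
  have q: "p ^ a > 0" using p(1) by (simp add: prime_gt_0_nat)
  have "card ?T = p ^ a" using c generate_pow_card[OF c(1)] by simp
  then have "order (G Mod ?T) * p ^ a = ?n"
    using lagrange[OF N.is_subgroup] by (simp add: order_def FactGroup_def)
  then have ordF: "order (G Mod ?T) = r" using r(1) q by (metis mult.commute nat_mult_eq_cancel1)
  have cop: "coprime (p ^ a) r" using r(2) p(1) by (simp add: prime_imp_coprime)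
  \<comment> \<open>Flattening gives a copy of the quotient over the element type of \<open>G\<close>, as the induction hypothesis requires.\<close>
  let ?rep = "\<lambda>U. SOME g. g \<in> U" and ?Q = "flatten (G Mod ?T) (\<lambda>U. SOME g. g \<in> U)"
  have iso: "?rep \<in> iso (G Mod ?T) ?Q" by (rule N.flatten_set_group_mod_iso)
  have ordQ: "order ?Q = r"
    using iso_same_order[OF iso] ordF by simp
  have "r > 0" using n r(1) by (auto intro: Nat.gr0I)
  have "p ^ a > 1" by (rule one_less_power[OF prime_gt_1_nat[OF p(1)] a])
  then have "r < ?n" using \<open>r > 0\<close> r(1) by simp
  moreover have "finite (carrier ?Q)"
    using ordQ \<open>r > 0\<close> by (intro card_ge_0_finite) (simp add: order_def)
  ultimately have "order_sums_bounded ?Q"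
    using IH[OF N.flatten_set_group_mod] ordQ by simp
  then have "order_sums_bounded (G Mod ?T)"
    using order_sums_bounded_iso[OF N.factorgroup_is_group N.flatten_set_group_mod iso] by blast
  then show ?thesis
    using order_sums_bounded_quotient[OF fin q N _ c] cop by (simp add: ordF)
qed

end

theorem finite_group_order_sums_bounded:
  assumes "group G" "finite (carrier G)"
  shows "order_sums_bounded G"
proof -
  \<comment> \<open>The induction runs over plain \<open>'a monoid\<close> records. One further step
    then covers \<open>G\<close>, whose record type may be an extension.\<close>
  have mon: "order_sums_bounded H" if "group H" "finite (carrier H)" for H :: "'a monoid"
    using that
  proof (induction "order H" arbitrary: H rule: less_induct)
    case less
    show ?case by (rule group.order_sums_bounded_step[OF less.prems]) (use less.hyps in blast)
  qed
  show ?thesis by (rule group.order_sums_bounded_step[OF assms]) (use mon in blast)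
qed

section \<open>Edges of the power graph\<close>

context group begin

text \<open>Two elements lie in each other's cyclic subgroup exactly if they generate the same one,
  that is, if \<open>h\<close> is an element of full order in the subgroup of
  \<open>g\<close>.\<close>

lemma card_mutual_generators:
  assumes fin: "finite (carrier G)" and g: "g \<in> carrier G"
  shows "card {h \<in> carrier G. h \<in> generate G {g} \<and> g \<in> generate G {h}} = totient (ord g)"
proof -
  have sub: "generate G {h} \<subseteq> generate G {g}" if "h \<in> generate G {g}" "g \<in> carrier G" for g h
    using that generate_subgroup_incl[of "{h}"] generate_is_subgroup[of "{g}"] by simp
  have in_self: "h \<in> generate G {h}" for h by (simp add: generate.incl)
  have gen_sub: "generate G {g} \<subseteq> carrier G" using g by (simp add: generate_incl)
  then have fin_gen: "finite (generate G {g})" using fin finite_subset by blast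
  have "{h \<in> carrier G. h \<in> generate G {g} \<and> g \<in> generate G {h}} = {h \<in> generate G {g}. ord h = ord g}"
  proof (intro Collect_cong iffI conjI; elim conjE)
    fix h assume h: "h \<in> carrier G" "h \<in> generate G {g}" "g \<in> generate G {h}"
    then have "generate G {h} = generate G {g}" using sub g by (intro equalityI) auto
    then show "ord h = ord g" using generate_pow_card h(1) g by simp
  next
    fix h assume h: "h \<in> generate G {g}" "ord h = ord g"
    then show hc: "h \<in> carrier G" using gen_sub by auto
    have "generate G {h} = generate G {g}"
      using sub[OF h(1) g] fin_gen h(2) generate_pow_card[OF hc] generate_pow_card[OF g]
      by (intro card_subset_eq) auto
    then show "g \<in> generate G {h}" using in_self by simp
  qed
  moreover have "int (card {h \<in> generate G {g}. ord h = ord g}) = int (totient (ord g))"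
  proof -
    have pos: "ord g > 0" using ord_ge_1[OF fin g] by simp
    \<comment> \<open>The count is a sum of an indicator function of the order, so
      \<open>sum_ord_generate\<close> evaluates it.\<close>
    have "int (card {h \<in> generate G {g}. ord h = ord g}) =
        (\<Sum>h\<in>generate G {g}. if ord h = ord g then 1 else 0)"
      using fin_gen by (simp add: sum.If_cases Int_def)
    also have "\<dots> = cyclic_sum (\<lambda>d. if d = ord g then 1 else 0) (ord g)"
      by (rule sum_ord_generate[OF g pos])
    also have "\<dots> = int (totient (ord g))"
      using pos by (simp add: cyclic_sum_def if_distrib[of "\<lambda>t. _ * t"] cong: if_cong)
    finally show ?thesis .
  qed
  ultimately show ?thesis by simp
qed

text \<open>Every edge gives two ordered pairs in \<open>R\<close>. Adding the diagonal to
  \<open>R\<close> yields the union of \<open>D\<close> and its converse, whose size follows by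
  inclusion-exclusion; the pairs in the intersection are counted by
  \<open>card_mutual_generators\<close>.\<close>

lemma card_power_graph_edges:
  assumes fin: "finite (carrier G)"
  shows "2 * int (card (power_graph_edges G)) =
    (\<Sum>g\<in>carrier G. edge_weight (ord g)) - int (order G)"
proof -
  define R where "R = {(g, h). power_graph_adj G g h}"
  define D where "D = (SIGMA g:carrier G. generate G {g})"
  have gen_sub: "generate G {g} \<subseteq> carrier G" if "g \<in> carrier G" for g
    using that by (simp add: generate_incl)
  have in_self: "g \<in> generate G {g}" for g by (simp add: generate.incl)
  have fin_gen: "finite (generate G {g})" if "g \<in> carrier G" for g
    using gen_sub[OF that] fin finite_subset by blast
  have finD: "finite D" unfolding D_def using fin fin_gen by (intro finite_SigmaI) auto
  have R_sub: "R \<subseteq> carrier G \<times> carrier G" by (auto simp: R_def power_graph_adj_def)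
  then have finR: "finite R" using fin finite_subset by blast
  have edges: "power_graph_edges G = (\<lambda>(g, h). {g, h}) ` R"
    by (auto simp: power_graph_edges_def R_def)
  have "card R = (\<Sum>e\<in>power_graph_edges G. card {r \<in> R. (\<lambda>(g, h). {g, h}) r = e})"
    unfolding edges using sum.image_gen[OF finR, of "\<lambda>_. 1::nat" "\<lambda>(g, h). {g, h}"] by simp
  also have "\<dots> = (\<Sum>e\<in>power_graph_edges G. 2)"
  proof (rule sum.cong [OF refl])
    fix e assume "e \<in> power_graph_edges G"
    then obtain g h where gh: "e = {g, h}" "power_graph_adj G g h"
      by (auto simp: power_graph_edges_def)
    then have "power_graph_adj G h g" "g \<noteq> h" by (auto simp: power_graph_adj_def)
    then have "{r \<in> R. (\<lambda>(g, h). {g, h}) r = e} = {(g, h), (h, g)}"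
      using gh by (auto simp: R_def doubleton_eq_iff)
    then show "card {r \<in> R. (\<lambda>(g, h). {g, h}) r = e} = 2" using \<open>g \<noteq> h\<close> by simp
  qed
  finally have cardR: "card R = 2 * card (power_graph_edges G)" by simp
  \<comment> \<open>\<open>D\<close> contains the diagonal while \<open>R\<close> avoids it; this
    accounts for the term \<open>order G\<close>.\<close>
  have "R \<union> Id_on (carrier G) = D \<union> D\<inverse>"
    using gen_sub in_self by (auto simp: R_def D_def power_graph_adj_iff_generate[OF fin])
  moreover have "R \<inter> Id_on (carrier G) = {}" by (auto simp: R_def power_graph_adj_def)
  moreover have "card (Id_on (carrier G)) = order G"
    by (simp add: Id_on_def UNION_singleton_eq_range card_image inj_on_def order_def)
  moreover have "finite (Id_on (carrier G))" using fin by (simp add: Id_on_def)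
  ultimately have "card R + order G = card (D \<union> D\<inverse>)"
    using finR by (metis card_Un_disjoint)
  moreover have "card (D \<union> D\<inverse>) + card (D \<inter> D\<inverse>) = 2 * card D"
    using card_Un_Int[of D "D\<inverse>"] finD by (simp add: card_inverse)
  moreover have "card D = (\<Sum>g\<in>carrier G. ord g)"
    unfolding D_def using fin fin_gen generate_pow_card by (subst card_SigmaI) auto
  moreover have "card (D \<inter> D\<inverse>) = (\<Sum>g\<in>carrier G. totient (ord g))"
  proof -
    have "D \<inter> D\<inverse> = (SIGMA g:carrier G. {h \<in> carrier G. h \<in> generate G {g} \<and> g \<in> generate G {h}})"
      by (auto simp: D_def)
    also have "card \<dots> = (\<Sum>g\<in>carrier G. totient (ord g))"
      using fin card_mutual_generators[OF fin] by (subst card_SigmaI) auto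
    finally show ?thesis .
  qed
  ultimately have "2 * card (power_graph_edges G) + order G + (\<Sum>g\<in>carrier G. totient (ord g))
      = 2 * (\<Sum>g\<in>carrier G. ord g)"
    using cardR by linarith
  then have "int (2 * card (power_graph_edges G) + order G + (\<Sum>g\<in>carrier G. totient (ord g)))
      = int (2 * (\<Sum>g\<in>carrier G. ord g))"
    by (rule arg_cong)
  then show ?thesis by (simp add: edge_weight_def sum_subtractf sum_distrib_left)
qed

end

lemma sum_ord_integer_mod_group:
  assumes "n \<ge> 1"
  shows "(\<Sum>x\<in>carrier (integer_mod_group n). h (group.ord (integer_mod_group n) x)) = cyclic_sum h n"
proof -
  let ?Z = "integer_mod_group n"
  interpret Z: group ?Z by simp
  \<comment> \<open>Reducing 1 modulo \<open>n\<close> covers \<open>n = 1\<close>, where 0 is the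
    only element.\<close>
  let ?x = "1 mod int n"
  have x: "?x \<in> carrier ?Z" using assms by (simp add: carrier_integer_mod_group)
  have "Z.ord ?x = n"
    by (subst Z.ord_unique[OF x]) (simp add: mod_mult_right_eq mod_eq_0_iff_dvd)
  moreover from this have "generate ?Z {?x} = carrier ?Z"
    using assms x Z.generate_pow_card[OF x] Z.generate_incl[of "{?x}"]
    by (intro card_subset_eq) (auto simp: carrier_integer_mod_group)
  ultimately show ?thesis using Z.sum_ord_generate[OF x, of h] assms by simp
qed

theorem theorem1p3:
  fixes n :: nat and G :: "('a, 'b) monoid_scheme"
  assumes "n \<ge> 1"
    and "group G" and "finite (carrier G)" and "order G = n"
  shows "card (power_graph_edges G) \<le> card (power_graph_edges (integer_mod_group n))"
proof -
  let ?Z = "integer_mod_group n"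
  have finZ: "finite (carrier ?Z)" using assms(1) by (simp add: carrier_integer_mod_group)
  have "2 * int (card (power_graph_edges G)) \<le> cyclic_sum edge_weight n - int n"
    using group.card_power_graph_edges[OF assms(2,3)] finite_group_order_sums_bounded[OF assms(2,3)] assms(4)
    by (simp add: order_sums_bounded_def)
  also have "\<dots> = 2 * int (card (power_graph_edges ?Z))"
    using group.card_power_graph_edges[OF group_integer_mod_group finZ]
      sum_ord_integer_mod_group[OF assms(1), of edge_weight] order_integer_mod_group[OF assms(1)]
    by simp
  finally show ?thesis by simp
qed

end
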